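(* Let $l,m$ be positive integers, $\omega>0$, and let $\bm{M}\in\mathbb{R}^{l\times m}$ satisfy $\inf_{\bm{j}\in\mathbb{Z}^m\setminus\{\bm{0}\}}|\bm{j}|^\omega\prod_{u=1}^l\|\bm{j}\cdot\mathrm{row}_u(\bm{M})\|>0$. Then there is a constant $C>0$ depending only on $\bm{M}$ such that for all integers $J\ge2$, $$\sum_{\substack{\bm{j}\in\mathbb{Z}^m\setminus\{\bm{0}\}\\|\bm{j}|\le J}}\prod_{u=1}^l\|\bm{j}\cdot\mathrm{row}_u(\bm{M})\|^{-1}\le C\,J^\omega(\log J)^l.$$
   Context: $\mathrm{row}_u(\bm{M})$ denotes the $u$-th row of $\bm{M}$, $\|y\|$ is the distance from $y\in\mathbb{R}$ to the nearest integer, and $|\bm{j}|$ is the supremum norm.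
   Formalization: The constant C is allowed to depend on ω as well as on M (ω being fixed together with M); a constant depending on M alone and serving all admissible ω does not exist in general. *)

theory Defs
  imports "HOL-Analysis.Analysis"
begin

definition dist_nearest_int :: "real \<Rightarrow> real"
  where "dist_nearest_int y = infdist y \<int>"

definition real_vec :: "int ^ 'n \<Rightarrow> real ^ 'n"
  where "real_vec j = (\<chi> i. real_of_int (j $ i))"

end

theory Submission
  imports Defs
begin

text \<open>
  Write \<open>s\<^sub>u(j)\<close> for the signed distance of \<open>j \<bullet> row u M\<close> to its nearest integer, and
  put \<open>\<epsilon> = c (2J)\<^sup>-\<^sup>\<omega>\<close>, where \<open>c\<close> is the infimum in the hypothesis (or 1 if smaller). Applied to
  differences, the hypothesis says that distinct \<open>j\<close>, \<open>j'\<close> in the ball of radius \<open>J\<close> satisfy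
  \<open>\<Prod>\<^sub>u \<bar>s\<^sub>u(j) - s\<^sub>u(j')\<bar> \<ge> \<epsilon>\<close>. Cut the cube into the dyadic boxes
  \<open>2\<^sup>-\<^sup>k\<^sup>-\<^sup>1 < \<bar>s\<^sub>u\<bar> \<le> 2\<^sup>-\<^sup>k\<close> with \<open>k = k\<^sub>u\<close>. Slicing a box of volume \<open>V\<close> along one coordinate
  shows by pigeonhole that it holds \<open>O(1 + V/\<epsilon>)\<close> points, and \<open>V \<ge> \<epsilon>\<close> if it holds any. Each
  point contributes \<open>O(1/V)\<close>, so each of the \<open>O((log (1/\<epsilon>))\<^sup>l)\<close> relevant boxes
  contributes \<open>O(1/\<epsilon>)\<close>.
\<close>

section \<open>Dyadic scales and separated points in boxes\<close>

definition dyadic_scale :: "real \<Rightarrow> nat"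
  where "dyadic_scale t = nat \<lfloor>- log 2 t\<rfloor>"

lemma dyadic_scale_bounds:
  assumes "0 < t" "t \<le> 1"
  shows "t \<le> (1/2) ^ dyadic_scale t" and "(1/2) ^ dyadic_scale t < 2 * t"
proof -
  let ?k = "dyadic_scale t"
  have "log 2 t \<le> 0" using assms by simp
  then have k: "real ?k = of_int \<lfloor>- log 2 t\<rfloor>"
    unfolding dyadic_scale_def by simp
  have pow: "(1/2::real) ^ ?k = 2 powr (- real ?k)"
    by (simp add: powr_minus powr_realpow divide_simps)
  have t: "t = 2 powr log 2 t" using assms by simp
  have le: "real ?k \<le> - log 2 t" unfolding k by simp
  have "2 powr log 2 t \<le> 2 powr (- real ?k)"
    using le by (intro powr_mono) auto
  then show "t \<le> (1/2) ^ ?k" using t pow by simp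
  have "- real ?k < 1 + log 2 t" unfolding k by linarith
  then have "2 powr (- real ?k) < 2 powr (1 + log 2 t)"
    by (intro powr_less_mono) auto
  also have "\<dots> = 2 * t" using assms by (simp add: powr_add)
  finally show "(1/2) ^ ?k < 2 * t" using pow by simp
qed

text \<open>Split the box by sign pattern and, along one coordinate, into slabs of thickness
  \<open>\<epsilon> / W\<close>, where \<open>W\<close> is the product of the other bounds
  \<open>(1/2) ^ k u\<close>. Two points sharing pattern and slab would have a product of
  differences below \<open>\<epsilon>\<close>, so each of the \<open>2 ^ CARD('l)\<close> patterns
  has at most one point per slab.\<close>

lemma card_separated_box_le:
  fixes s :: "'a \<Rightarrow> 'l::finite \<Rightarrow> real" and k :: "'l \<Rightarrow> nat"
  assumes eps: "0 < \<epsilon>"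
    and box: "\<And>x u. x \<in> B \<Longrightarrow> \<bar>s x u\<bar> \<le> (1/2) ^ k u"
    and sep: "\<And>x y. x \<in> B \<Longrightarrow> y \<in> B \<Longrightarrow> x \<noteq> y \<Longrightarrow> \<epsilon> \<le> (\<Prod>u\<in>UNIV. \<bar>s x u - s y u\<bar>)"
  shows "real (card B) \<le> 2 ^ CARD('l) * ((\<Prod>u\<in>UNIV. (1/2) ^ k u) / \<epsilon> + 1)"
proof -
  \<comment> \<open>The slicing direction is arbitrary; one exists because types are
    nonempty.\<close>
  obtain u0 :: 'l where True by blast
  define W where "W = (\<Prod>u\<in>UNIV-{u0}. (1/2::real) ^ k u)"
  define V where "V = (\<Prod>u\<in>UNIV. (1/2::real) ^ k u)"
  have V: "V = (1/2) ^ k u0 * W" unfolding V_def W_def by (subst prod.remove[of _ u0]) auto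
  have W0: "W > 0" unfolding W_def by (intro prod_pos) simp
  have V0: "V > 0" unfolding V_def by (intro prod_pos) simp
  define N where "N = nat \<lfloor>V / \<epsilon>\<rfloor>"
  define g where "g x = ({u. s x u > 0}, nat \<lfloor>\<bar>s x u0\<bar> * W / \<epsilon>\<rfloor>)" for x
  have "g ` B \<subseteq> UNIV \<times> {..N}"
  proof
    fix p assume "p \<in> g ` B"
    then obtain x where x: "x \<in> B" "p = g x" by blast
    have "\<bar>s x u0\<bar> * W / \<epsilon> \<le> V / \<epsilon>"
      unfolding V using box[OF x(1), of u0] W0 eps
      by (intro divide_right_mono mult_right_mono) auto
    then have "snd p \<le> N" unfolding x g_def N_def by (simp add: nat_mono floor_mono)
    then show "p \<in> UNIV \<times> {..N}" by (cases p) auto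
  qed
  moreover have "inj_on g B"
  proof (rule inj_onI, rule ccontr)
    fix x y assume xy: "x \<in> B" "y \<in> B" "g x = g y" "x \<noteq> y"
    \<comment> \<open>Within one sign pattern a coordinate gap is the gap of the absolute values,
      hence at most \<open>(1/2) ^ k u\<close> rather than twice that. Zero may be counted with the
      negatives.\<close>
    have sgn: "s x u > 0 \<longleftrightarrow> s y u > 0" for u using xy(3) unfolding g_def by auto
    have close: "\<bar>s x u - s y u\<bar> = \<bar>\<bar>s x u\<bar> - \<bar>s y u\<bar>\<bar>" for u
      using sgn[of u] by auto
    have "nat \<lfloor>\<bar>s x u0\<bar> * W / \<epsilon>\<rfloor> = nat \<lfloor>\<bar>s y u0\<bar> * W / \<epsilon>\<rfloor>" using xy(3) by (simp add: g_def)
    moreover have "0 \<le> \<bar>s x u0\<bar> * W / \<epsilon>" "0 \<le> \<bar>s y u0\<bar> * W / \<epsilon>" using W0 eps by auto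
    ultimately have "\<lfloor>\<bar>s x u0\<bar> * W / \<epsilon>\<rfloor> = \<lfloor>\<bar>s y u0\<bar> * W / \<epsilon>\<rfloor>"
      by (metis nat_0_le zero_le_floor)
    then have "\<bar>\<bar>s x u0\<bar> * W / \<epsilon> - \<bar>s y u0\<bar> * W / \<epsilon>\<bar> < 1" by linarith
    moreover have "\<bar>\<bar>s x u0\<bar> * W / \<epsilon> - \<bar>s y u0\<bar> * W / \<epsilon>\<bar> = \<bar>s x u0 - s y u0\<bar> * W / \<epsilon>"
      unfolding close using W0 eps
      by (simp add: abs_mult flip: left_diff_distrib diff_divide_distrib)
    ultimately have less: "\<bar>s x u0 - s y u0\<bar> * W < \<epsilon>"
      using eps by (simp only: pos_divide_less_eq mult_1)
    have "(\<Prod>u\<in>UNIV. \<bar>s x u - s y u\<bar>)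
        = \<bar>s x u0 - s y u0\<bar> * (\<Prod>u\<in>UNIV-{u0}. \<bar>s x u - s y u\<bar>)"
      by (subst prod.remove[of _ u0]) auto
    also have "\<dots> \<le> \<bar>s x u0 - s y u0\<bar> * W"
      unfolding W_def
    proof (intro mult_left_mono prod_mono conjI)
      fix u
      show "\<bar>s x u - s y u\<bar> \<le> (1/2) ^ k u"
        unfolding close using box[OF xy(1), of u] box[OF xy(2), of u] by linarith
    qed auto
    finally show False using sep[OF xy(1,2,4)] less by simp
  qed
  ultimately have "card B \<le> card ((UNIV :: 'l set set) \<times> {..N})"
    by (intro card_inj_on_le) auto
  also have "\<dots> = 2 ^ CARD('l) * (N + 1)"
    using card_Pow[of "UNIV :: 'l set"] by (simp add: card_cartesian_product)
  finally have "real (card B) \<le> real (2 ^ CARD('l) * (N + 1))"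
    by (rule of_nat_mono)
  also have "\<dots> = 2 ^ CARD('l) * (real N + 1)" by (simp add: algebra_simps)
  also have "\<dots> \<le> 2 ^ CARD('l) * (V / \<epsilon> + 1)"
    using V0 eps unfolding N_def by (intro mult_left_mono) auto
  finally show ?thesis unfolding V_def .
qed

text \<open>Group the points by their vectors of scales. In \<open>2 * 4 ^ CARD('l)\<close>, one
  factor \<open>2 ^ CARD('l)\<close> counts sign patterns, the other comes from each
  \<open>\<bar>s x u\<bar>\<close> exceeding half its dyadic bound, and the 2 absorbs the
  \<open>+ 1\<close> of the box count.\<close>

lemma sum_inverse_prod_separated_le:
  fixes s :: "'a \<Rightarrow> 'l::finite \<Rightarrow> real"
  assumes fin: "finite A" and eps: "0 < \<epsilon>" "\<epsilon> \<le> 1"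
    and bnd: "\<And>x u. x \<in> A \<Longrightarrow> \<bar>s x u\<bar> \<le> 1"
    and low: "\<And>x. x \<in> A \<Longrightarrow> \<epsilon> \<le> (\<Prod>u\<in>UNIV. \<bar>s x u\<bar>)"
    and sep: "\<And>x y. x \<in> A \<Longrightarrow> y \<in> A \<Longrightarrow> x \<noteq> y \<Longrightarrow> \<epsilon> \<le> (\<Prod>u\<in>UNIV. \<bar>s x u - s y u\<bar>)"
  shows "(\<Sum>x\<in>A. \<Prod>u\<in>UNIV. inverse \<bar>s x u\<bar>)
          \<le> (2 * 4 ^ CARD('l) / \<epsilon>) * (1 - log 2 \<epsilon>) ^ CARD('l)"
proof -
  define k where "k x = (\<lambda>u. dyadic_scale \<bar>s x u\<bar>)" for x
  \<comment> \<open>No coordinate is smaller than \<open>\<epsilon>\<close> in absolute value,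
    because the other factors of the product are at most 1; so \<open>n\<close> bounds every scale
    that occurs.\<close>
  define n where "n = nat \<lfloor>- log 2 \<epsilon>\<rfloor>"
  define K where "K = (UNIV :: 'l set) \<rightarrow>\<^sub>E {..n}"
  have ge: "\<epsilon> \<le> \<bar>s x u\<bar>" if "x \<in> A" for x u
  proof -
    have "\<epsilon> \<le> \<bar>s x u\<bar> * (\<Prod>v\<in>UNIV-{u}. \<bar>s x v\<bar>)"
      using low[OF that] by (subst (asm) prod.remove[of _ u]) auto
    also have "\<dots> \<le> \<bar>s x u\<bar> * 1"
      by (intro mult_left_mono prod_le_1) (auto simp: bnd that)
    finally show ?thesis by simp
  qed
  have pos: "0 < \<bar>s x u\<bar>" if "x \<in> A" for x u using ge[OF that, of u] eps by linarith
  have kK: "k ` A \<subseteq> K"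
  proof
    fix q assume "q \<in> k ` A"
    then obtain x where x: "x \<in> A" "q = k x" by blast
    have "k x u \<le> n" for u
      unfolding k_def n_def dyadic_scale_def
      using ge[OF x(1), of u] eps by (intro nat_mono floor_mono) auto
    then show "q \<in> K" unfolding K_def x by auto
  qed
  have finK: "finite K" unfolding K_def by (intro finite_PiE) auto
  have fibre: "(\<Sum>x\<in>{x\<in>A. k x = q}. \<Prod>u\<in>UNIV. inverse \<bar>s x u\<bar>) \<le> 2 * 4 ^ CARD('l) / \<epsilon>"
    for q :: "'l \<Rightarrow> nat"
  proof (cases "{x\<in>A. k x = q} = {}")
    \<comment> \<open>Empty boxes are set aside: the bound \<open>\<epsilon> \<le> V\<close> needs a
      point in the box.\<close>
    case True
    show ?thesis unfolding True using eps by simp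
  next
    case False
    define B where "B = {x\<in>A. k x = q}"
    define V where "V = (\<Prod>u\<in>UNIV. (1/2::real) ^ q u)"
    have V0: "V > 0" unfolding V_def by (intro prod_pos) simp
    have up: "\<bar>s x u\<bar> \<le> (1/2) ^ q u" "(1/2) ^ q u < 2 * \<bar>s x u\<bar>" if "x \<in> B" for x u
      using dyadic_scale_bounds[of "\<bar>s x u\<bar>"] pos[of x u] bnd[of x u] that
      unfolding B_def k_def by auto
    have card': "real (card B) \<le> 2 ^ CARD('l) * (V / \<epsilon> + 1)"
      unfolding V_def
      by (rule card_separated_box_le[OF eps(1), of B s q])
         (use up sep in \<open>auto simp: B_def\<close>)
    from False obtain x0 where x0: "x0 \<in> B" unfolding B_def by blast
    then have "\<epsilon> \<le> (\<Prod>u\<in>UNIV. \<bar>s x0 u\<bar>)" using low by (auto simp: B_def)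
    also have "\<dots> \<le> V" unfolding V_def by (intro prod_mono) (use up x0 in auto)
    finally have "1 \<le> V / \<epsilon>" using eps by simp
    then have "2 ^ CARD('l) * (V / \<epsilon> + 1) \<le> 2 ^ CARD('l) * (2 * (V / \<epsilon>))"
      by (intro mult_left_mono) auto
    with card' have card: "real (card B) \<le> 2 ^ CARD('l) * (2 * (V / \<epsilon>))" by linarith
    have "(\<Prod>u\<in>UNIV. inverse \<bar>s x u\<bar>) \<le> 2 ^ CARD('l) / V" if "x \<in> B" for x
    proof -
      have "(\<Prod>u\<in>UNIV. inverse \<bar>s x u\<bar>) \<le> (\<Prod>u\<in>UNIV. 2 / (1/2) ^ q u)"
      proof (intro prod_mono conjI)
        fix u
        have "0 < \<bar>s x u\<bar>" using pos that by (auto simp: B_def)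
        then show "inverse \<bar>s x u\<bar> \<le> 2 / (1/2) ^ q u"
          using up(2)[OF that, of u] by (simp add: field_simps)
      qed auto
      also have "\<dots> = 2 ^ CARD('l) / V" unfolding V_def by (simp add: prod_dividef)
      finally show ?thesis .
    qed
    then have "(\<Sum>x\<in>B. \<Prod>u\<in>UNIV. inverse \<bar>s x u\<bar>) \<le> real (card B) * (2 ^ CARD('l) / V)"
      by (intro sum_bounded_above) auto
    also have "\<dots> \<le> 2 ^ CARD('l) * (2 * (V / \<epsilon>)) * (2 ^ CARD('l) / V)"
      using V0 card by (intro mult_right_mono) auto
    also have "\<dots> = 2 * (2 ^ CARD('l) * 2 ^ CARD('l)) / \<epsilon>" using V0 by simp
    also have "\<dots> = 2 * 4 ^ CARD('l) / \<epsilon>" by (simp flip: power_mult_distrib)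
    finally show ?thesis unfolding B_def .
  qed
  have "(\<Sum>x\<in>A. \<Prod>u\<in>UNIV. inverse \<bar>s x u\<bar>)
      = (\<Sum>q\<in>K. \<Sum>x\<in>{x\<in>A. k x = q}. \<Prod>u\<in>UNIV. inverse \<bar>s x u\<bar>)"
    by (rule sum.group[OF fin finK kK, symmetric])
  also have "\<dots> \<le> real (card K) * (2 * 4 ^ CARD('l) / \<epsilon>)"
    by (intro sum_bounded_above fibre)
  also have "real (card K) = (1 + real n) ^ CARD('l)"
    unfolding K_def by (simp add: card_PiE)
  also have "\<dots> * (2 * 4 ^ CARD('l) / \<epsilon>) \<le> (1 - log 2 \<epsilon>) ^ CARD('l) * (2 * 4 ^ CARD('l) / \<epsilon>)"
  proof (intro mult_right_mono power_mono)
    have "log 2 \<epsilon> \<le> 0" using eps by simp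
    then show "1 + real n \<le> 1 - log 2 \<epsilon>" unfolding n_def by simp
  qed (use eps in auto)
  finally show ?thesis by (simp add: mult.commute)
qed

section \<open>Distance to the nearest integer and integer vectors in a ball\<close>

lemma dist_nearest_int_le: "dist_nearest_int y \<le> \<bar>y - of_int n\<bar>"
  unfolding dist_nearest_int_def using infdist_le[of "of_int n" \<int> y] by (simp add: dist_real_def)

text \<open>Rounding attains the infimum over the integers. This turns the distance into the
  absolute value of a signed offset, and signed offsets can be subtracted.\<close>

lemma dist_nearest_int_eq_round: "dist_nearest_int y = \<bar>y - of_int (round y)\<bar>"
proof (rule antisym[OF dist_nearest_int_le])
  have "\<bar>y - of_int (round y)\<bar> \<le> (INF a\<in>\<int>. dist y a)"
    by (rule cINF_greatest) (auto elim!: Ints_cases simp: dist_real_def round_diff_minimal)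
  also have "\<dots> = dist_nearest_int y"
    unfolding dist_nearest_int_def by (subst infdist_notempty) auto
  finally show "\<bar>y - of_int (round y)\<bar> \<le> dist_nearest_int y" .
qed

lemma dist_nearest_int_nonneg: "0 \<le> dist_nearest_int y"
  by (simp add: dist_nearest_int_eq_round)

lemma real_vec_diff: "real_vec (i - j) = real_vec i - real_vec j"
  by (simp add: real_vec_def vec_eq_iff)

lemma finite_infnorm_real_vec_le: "finite {j :: int ^ 'm. infnorm (real_vec j) \<le> of_int J}"
proof (rule inj_on_finite)
  show "inj_on vec_nth {j :: int ^ 'm. infnorm (real_vec j) \<le> of_int J}"
    by (auto simp: inj_on_def vec_eq_iff)
  show "vec_nth ` {j :: int ^ 'm. infnorm (real_vec j) \<le> of_int J} \<subseteq> UNIV \<rightarrow>\<^sub>E {-J..J}"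
  proof (intro image_subsetI PiE_I)
    fix j :: "int ^ 'm" and i assume "j \<in> {j. infnorm (real_vec j) \<le> of_int J}"
    then have "\<bar>real_of_int (j $ i)\<bar> \<le> of_int J"
      using component_le_infnorm_cart[of "real_vec j" i] by (simp add: real_vec_def)
    then show "j $ i \<in> {-J..J}" by auto
  qed auto
qed (auto intro: finite_PiE)

section \<open>Application to the rows of the matrix\<close>

theorem theorem2p1:
  fixes M :: "real ^ 'm ^ 'l" and \<omega> :: real
  assumes "\<omega> > 0"
    and "(INF j\<in>{j :: int ^ 'm. j \<noteq> 0}. infnorm (real_vec j) powr \<omega> *
           (\<Prod>u\<in>UNIV. dist_nearest_int (real_vec j \<bullet> row u M))) > 0"
  shows "\<exists>C>0. \<forall>J::int. J \<ge> 2 \<longrightarrow>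
           (\<Sum>j\<in>{j :: int ^ 'm. j \<noteq> 0 \<and> infnorm (real_vec j) \<le> real_of_int J}.
              \<Prod>u\<in>UNIV. inverse (dist_nearest_int (real_vec j \<bullet> row u M)))
           \<le> C * real_of_int J powr \<omega> * ln (real_of_int J) ^ CARD('l)"
proof -
  define P where "P j = (\<Prod>u\<in>UNIV. dist_nearest_int (real_vec j \<bullet> row u M))" for j :: "int ^ 'm"
  define c0 where "c0 = (INF j\<in>{j :: int ^ 'm. j \<noteq> 0}. infnorm (real_vec j) powr \<omega> * P j)"
  \<comment> \<open>The cap at 1 ensures \<open>log 2 c \<le> 0\<close> and later
    \<open>\<epsilon> \<le> 1\<close>.\<close>
  define c where "c = min c0 1"
  have c: "0 < c" "c \<le> 1" using assms(2) unfolding c_def c0_def P_def by auto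
  have P0: "0 \<le> P j" for j unfolding P_def by (intro prod_nonneg) (simp add: dist_nearest_int_nonneg)
  have cP: "c \<le> infnorm (real_vec j) powr \<omega> * P j" if "j \<noteq> 0" for j
  proof -
    have "c0 \<le> infnorm (real_vec j) powr \<omega> * P j"
      unfolding c0_def using that P0
      by (intro cINF_lower bdd_belowI2[of _ 0]) auto
    then show ?thesis unfolding c_def by simp
  qed
  define s where "s j u = real_vec j \<bullet> row u M - of_int (round (real_vec j \<bullet> row u M))"
    for j :: "int ^ 'm" and u
  have d: "dist_nearest_int (real_vec j \<bullet> row u M) = \<bar>s j u\<bar>" for j u
    by (simp add: s_def dist_nearest_int_eq_round)
  \<comment> \<open>The difference of the two nearest integers is an integer, hence a competitor for
    the form at \<open>i - j\<close>.\<close>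
  have diff: "dist_nearest_int (real_vec (i - j) \<bullet> row u M) \<le> \<bar>s i u - s j u\<bar>" for i j u
    using dist_nearest_int_le[of "real_vec (i - j) \<bullet> row u M"
        "round (real_vec i \<bullet> row u M) - round (real_vec j \<bullet> row u M)"]
    by (simp add: s_def real_vec_diff algebra_simps)
  \<comment> \<open>Chosen so that \<open>1 - log 2 \<epsilon> \<le> D * ln J\<close>; one
    \<open>\<omega>\<close> stems from the factor 2 in \<open>2 * J\<close>, the other from
    \<open>J\<close>.\<close>
  define D where "D = (1 + \<omega> - log 2 c + \<omega>) / ln 2"
  have logc: "log 2 c \<le> 0" using c by simp
  have D: "D > 0" unfolding D_def using logc assms(1) by (intro divide_pos_pos) auto
  define C where "C = 2 * 4 ^ CARD('l) * 2 powr \<omega> / c * D ^ CARD('l)"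
  have "C > 0" unfolding C_def using c D by simp
  moreover have "(\<Sum>j\<in>{j :: int ^ 'm. j \<noteq> 0 \<and> infnorm (real_vec j) \<le> real_of_int J}.
              \<Prod>u\<in>UNIV. inverse (dist_nearest_int (real_vec j \<bullet> row u M)))
           \<le> C * real_of_int J powr \<omega> * ln (real_of_int J) ^ CARD('l)" if J: "J \<ge> 2" for J :: int
  proof -
    let ?A = "{j :: int ^ 'm. j \<noteq> 0 \<and> infnorm (real_vec j) \<le> real_of_int J}"
    have J2: "real_of_int J \<ge> 2" using J by simp
    \<comment> \<open>Radius \<open>2 * J\<close> covers both the vectors of the sum and their
      differences, so one \<open>\<epsilon>\<close> serves as lower bound and as separation.\<close>
    define \<epsilon> where "\<epsilon> = c / (2 * of_int J) powr \<omega>"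
    have pw: "(2 * real_of_int J) powr \<omega> \<ge> 1" using J2 assms(1) by (intro ge_one_powr_ge_zero) auto
    have eps: "0 < \<epsilon>" "\<epsilon> \<le> 1" unfolding \<epsilon>_def using c pw J2 by (auto simp: divide_simps)
    have low: "\<epsilon> \<le> P j" if "j \<noteq> 0" "infnorm (real_vec j) \<le> 2 * of_int J" for j
    proof -
      have "c \<le> infnorm (real_vec j) powr \<omega> * P j" by (rule cP[OF that(1)])
      also have "\<dots> \<le> (2 * of_int J) powr \<omega> * P j"
        using that(2) assms(1) P0 by (intro mult_right_mono powr_mono2) (auto simp: infnorm_pos_le)
      finally show ?thesis unfolding \<epsilon>_def using pw J2 by (simp add: field_simps)
    qed
    have "(\<Sum>j\<in>?A. \<Prod>u\<in>UNIV. inverse \<bar>s j u\<bar>)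
        \<le> (2 * 4 ^ CARD('l) / \<epsilon>) * (1 - log 2 \<epsilon>) ^ CARD('l)"
    proof (rule sum_inverse_prod_separated_le)
      show "finite ?A" by (rule finite_subset[OF _ finite_infnorm_real_vec_le[of J]]) auto
      show "\<bar>s j u\<bar> \<le> 1" for j u
        unfolding s_def using of_int_round_abs_le[of "real_vec j \<bullet> row u M"] by linarith
      show "\<epsilon> \<le> (\<Prod>u\<in>UNIV. \<bar>s j u\<bar>)" if "j \<in> ?A" for j
        using low[of j] that J2 unfolding P_def d by auto
      show "\<epsilon> \<le> (\<Prod>u\<in>UNIV. \<bar>s i u - s j u\<bar>)" if "i \<in> ?A" "j \<in> ?A" "i \<noteq> j" for i j
      proof -
        have "infnorm (real_vec (i - j)) \<le> infnorm (real_vec i) + infnorm (real_vec j)"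
          using infnorm_triangle[of "real_vec i" "- real_vec j"]
          by (simp add: real_vec_diff infnorm_neg)
        then have "\<epsilon> \<le> P (i - j)" using that by (intro low) auto
        also have "\<dots> \<le> (\<Prod>u\<in>UNIV. \<bar>s i u - s j u\<bar>)"
          unfolding P_def using diff by (intro prod_mono) (auto simp: dist_nearest_int_nonneg)
        finally show ?thesis .
      qed
    qed (use eps in auto)
    also have "\<dots> \<le> (2 * 4 ^ CARD('l) / \<epsilon>) * (D * ln (of_int J)) ^ CARD('l)"
    proof (intro mult_left_mono power_mono)
      have lnJ: "ln 2 \<le> ln (real_of_int J)" using J2 by simp
      have "log 2 \<epsilon> = log 2 c - \<omega> * (1 + log 2 (of_int J))"
        unfolding \<epsilon>_def using c J2 by (simp add: log_divide log_powr log_mult)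
      then have "1 - log 2 \<epsilon> = (1 + \<omega> - log 2 c) * 1 + \<omega> * (ln (of_int J) / ln 2)"
        by (simp add: log_def[of 2 "of_int J"] algebra_simps)
      \<comment> \<open>Here \<open>J \<ge> 2\<close> enters: \<open>ln J / ln 2\<close> is at least
        1, so the nonnegative constant term is absorbed into the logarithm.\<close>
      also have "\<dots> \<le> (1 + \<omega> - log 2 c) * (ln (of_int J) / ln 2) + \<omega> * (ln (of_int J) / ln 2)"
        using lnJ logc assms(1) by (intro add_right_mono mult_left_mono) auto
      also have "\<dots> = D * ln (of_int J)"
        unfolding D_def by (simp add: add_divide_distrib diff_divide_distrib algebra_simps)
      finally show "1 - log 2 \<epsilon> \<le> D * ln (of_int J)" .
      have "log 2 \<epsilon> \<le> 0" using eps by simp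
      then show "0 \<le> 1 - log 2 \<epsilon>" by simp
    qed (use eps in auto)
    also have "\<dots> = C * of_int J powr \<omega> * ln (of_int J) ^ CARD('l)"
      unfolding C_def \<epsilon>_def using J2 c by (simp add: powr_mult power_mult_distrib)
    finally show ?thesis unfolding d .
  qed
  ultimately show ?thesis by blast
qed

end
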